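(* Let $\min(n,m)\ge 2$ and let $M\in\mathbb{R}^{(n+1)\times(m+1)}$ have first row $M_0^T$ (with $M_0\in\mathbb{R}^{m+1}$) and remaining rows $\bar M\in\mathbb{R}^{n\times(m+1)}$, so that $M=\begin{pmatrix}M_0^T\\ \bar M\end{pmatrix}$. (i) If $M_0\notin L_{m+1}$, then $M\notin\mathrm{LOP}(n+1,m+1)$. (ii) If $M_0\in L_{m+1}$, then $M\in\mathrm{LOP}(n+1,m+1)$ if and only if the optimal value of the trust-region subproblem $$\min\left\{(M_0^Tx)^2-\|\bar M x\|^2 \;:\; x=\begin{pmatrix}1\\ \bar x\end{pmatrix},\ \bar x\in\mathbb{R}^m,\ \|\bar x\|\le 1\right\}$$ is nonnegative. (iii) Suppose $M_0\in L_{m+1}$ and $x=(1;\bar x)$ with $\|\bar x\|\le 1$ satisfies $M_0^Tx<\|\bar Mx\|$. Put $\bar v=\bar Mx$. Then $\bar v\ne 0$, and with $y=(1;-\bar v/\|\bar v\|)$ and $A=yx^T$ one has $\langle A,S\rangle\ge 0$ for every $S\in\mathrm{LOP}(n+1,m+1)$ while $\langle A,M\rangle<0$; that is, $\langle A,S\rangle\ge 0$ is a valid linear inequality for $\mathrm{LOP}(n+1,m+1)$ that separates $M$ from $\mathrm{LOP}(n+1,m+1)$.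
   Context: All matrices are real; $\langle A,B\rangle=\mathrm{tr}(AB^T)$; $\|\cdot\|$ is the Euclidean norm; $(a;b)$ denotes vertical concatenation. The Lorentz cone in $\mathbb{R}^r$ ($r\ge 3$) is $L_r=\{(y_0,\ldots,y_{r-1})^T : \sum_{i=1}^{r-1}y_i^2\le y_0^2,\ y_0\ge 0\}$. The Lorentz positive cone is $\mathrm{LOP}(n+1,m+1)=\{M\in\mathbb{R}^{(n+1)\times(m+1)} : Mx\in L_{n+1}\ \text{for all } x\in L_{m+1}\}$. *)

theory Defs
  imports "HOL-Analysis.Analysis"
begin

(* R^(k+1) is rendered as real ^ 'k option with CARD('k) = k: the component numbered 0
   is the one at index None, and the components 1, ..., k are those at Some i for i :: 'k.
   Likewise an (n+1) x (m+1) matrix has type real ^ 'm option ^ 'n option. *)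

text \<open>Vertical concatenation with a one-row top block. For \<open>'a = real\<close> this prepends an entry
  to a column vector; for \<open>'a = real ^ 'c\<close> it prepends a row to a matrix.\<close>

definition vconcat :: "'a \<Rightarrow> 'a ^ 'k \<Rightarrow> 'a ^ 'k::finite option" where
  "vconcat a b = (\<chi> i. case i of None \<Rightarrow> a | Some j \<Rightarrow> b $ j)"

definition lorentz_cone :: "(real ^ 'k::finite option) set" where
  "lorentz_cone = {y. (\<Sum>i\<in>UNIV. (y $ Some i)\<^sup>2) \<le> (y $ None)\<^sup>2 \<and> 0 \<le> y $ None}"

definition LOP :: "(real ^ 'm::finite option ^ 'n::finite option) set" where
  "LOP = {M. \<forall>x\<in>lorentz_cone. M *v x \<in> lorentz_cone}"

definition mat_inner :: "real ^ 'c::finite ^ 'r::finite \<Rightarrow> real ^ 'c ^ 'r \<Rightarrow> real" where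
  "mat_inner A B = trace (A ** transpose B)"

definition outer :: "real ^ 'r::finite \<Rightarrow> real ^ 'c::finite \<Rightarrow> real ^ 'c ^ 'r" where
  "outer y x = (columnvector y :: real ^ 1 ^ 'r) ** (rowvector x :: real ^ 'c ^ 1)"

definition trs_feasible :: "(real ^ 'm::finite option) set" where
  "trs_feasible = {vconcat 1 xb | xb. norm xb \<le> 1}"

definition trs_objective ::
  "real ^ 'm::finite option \<Rightarrow> real ^ 'm option ^ 'n::finite \<Rightarrow> real ^ 'm option \<Rightarrow> real" where
  "trs_objective M0 Mbar x = (M0 \<bullet> x)\<^sup>2 - (norm (Mbar *v x))\<^sup>2"

end

theory Submission
  imports Defs
begin

text \<open>
  The argument rests on the self-duality of the Lorentz cone: a vector lies in the cone exactly
  when its inner product with every vector of the cone is nonnegative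
  (\<open>lorentz_cone_self_dual\<close>).

  The top entry of \<open>M x\<close> is \<open>M\<^sub>0 \<bullet> x\<close>, so a Lorentz-positive matrix has \<open>M\<^sub>0\<close> in the dual cone,
  which is the cone itself; this is the first claim.

  Up to positive scaling the nonzero vectors of the cone are the feasible points \<open>(1; b)\<close> with
  \<open>norm b \<le> 1\<close>, so Lorentz positivity only has to be tested there, where it says
  \<open>norm (Mbar x) \<le> M\<^sub>0 \<bullet> x\<close> (\<open>vconcat_in_LOP_iff\<close>). If \<open>M\<^sub>0\<close> lies in the cone, the right-hand side
  is nonnegative by self-duality, hence squaring loses nothing and the condition becomes
  nonnegativity of the quadratic objective. The optimal value is attained, since the feasible
  set is a continuous image of a closed ball, and so its sign decides the matter.

  A feasible \<open>x\<close> that violates the inequality gives a separating functional because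
  \<open>\<langle>y x\<^sup>T, S\<rangle> = y \<bullet> (S x)\<close>: this is nonnegative for positive \<open>S\<close> whenever \<open>x\<close> and \<open>y\<close> lie in the
  cone. The vector \<open>y = (1; - v / norm v)\<close> with \<open>v = Mbar x\<close> is the boundary ray for which
  \<open>y \<bullet> (M x) = M\<^sub>0 \<bullet> x - norm v\<close> exposes the violation.
\<close>

lemma vconcat_None [simp]: "vconcat a b $ None = a"
  and vconcat_Some [simp]: "vconcat a b $ Some j = b $ j"
  by (simp_all add: vconcat_def)

lemma vconcat_cases:
  obtains a b where "x = vconcat a b"
proof
  show "x = vconcat (x $ None) (\<chi> i. x $ Some i)"
    by (simp add: vconcat_def vec_eq_iff split: option.split)
qed

lemma scaleR_vconcat: "c *\<^sub>R vconcat a b = vconcat (c * a) (c *\<^sub>R b)" for a :: real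
  by (simp add: vconcat_def vec_eq_iff split: option.split)

lemma inner_vconcat: "vconcat a b \<bullet> vconcat c d = a * c + b \<bullet> d" for a c :: real
  by (simp add: inner_vec_def UNIV_option_conv sum.reindex)

lemma vconcat_mult_vector: "vconcat M0 Mbar *v x = vconcat (M0 \<bullet> x) (Mbar *v x)"
  for x :: "real ^ 'c::finite"
  by (simp add: vconcat_def vec_eq_iff matrix_vector_mult_def inner_vec_def split: option.split)

lemma vconcat_in_lorentz_cone_iff: "vconcat a b \<in> lorentz_cone \<longleftrightarrow> norm b \<le> a"
proof -
  have "(\<Sum>i\<in>UNIV. (b $ i)\<^sup>2) = (norm b)\<^sup>2"
    unfolding power2_norm_eq_inner by (simp add: inner_vec_def power2_eq_square)
  then show ?thesis
    using order_trans[OF norm_ge_zero, of b a]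
    by (auto simp: lorentz_cone_def intro: power2_le_imp_le power_mono)
qed

text \<open>One direction is the Cauchy-Schwarz inequality. For the other, testing \<open>(a; b)\<close> against the
  reflected boundary vector \<open>(norm b; - b)\<close> gives \<open>norm b \<le> a\<close>, except when \<open>b = 0\<close>, where
  that vector vanishes and the axis \<open>(1; 0)\<close> takes over.\<close>

lemma lorentz_cone_self_dual:
  "y \<in> lorentz_cone \<longleftrightarrow> (\<forall>x\<in>lorentz_cone. 0 \<le> y \<bullet> x)"
proof (cases y rule: vconcat_cases)
  case (1 a b)
  show ?thesis
  proof
    assume "y \<in> lorentz_cone"
    then have ab: "norm b \<le> a"
      by (simp add: 1 vconcat_in_lorentz_cone_iff)
    show "\<forall>x\<in>lorentz_cone. 0 \<le> y \<bullet> x"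
    proof
      fix x :: "real ^ 'a option"
      assume "x \<in> lorentz_cone"
      then obtain c d where x: "x = vconcat c d" and cd: "norm d \<le> c"
        by (metis vconcat_cases vconcat_in_lorentz_cone_iff)
      have "\<bar>b \<bullet> d\<bar> \<le> norm b * norm d"
        by (rule Cauchy_Schwarz_ineq2)
      also have "\<dots> \<le> a * c"
        using ab cd order_trans[OF norm_ge_zero ab] by (intro mult_mono) auto
      finally show "0 \<le> y \<bullet> x"
        by (simp add: 1 x inner_vconcat)
    qed
  next
    assume dual: "\<forall>x\<in>lorentz_cone. 0 \<le> y \<bullet> x"
    have "norm b \<le> a"
    proof (cases "b = 0")
      case True
      have "0 \<le> y \<bullet> vconcat 1 0"
        using dual by (simp add: vconcat_in_lorentz_cone_iff)
      then show ?thesis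
        by (simp add: 1 inner_vconcat True)
    next
      case False
      have "0 \<le> y \<bullet> vconcat (norm b) (- b)"
        using dual by (simp add: vconcat_in_lorentz_cone_iff)
      then have "norm b * norm b \<le> a * norm b"
        by (simp add: 1 inner_vconcat norm_eq_square dot_square_norm power2_eq_square)
      then show ?thesis
        using False by simp
    qed
    then show "y \<in> lorentz_cone"
      by (simp add: 1 vconcat_in_lorentz_cone_iff)
  qed
qed

lemma inner_lorentz_cone_nonneg:
  "y \<in> lorentz_cone \<Longrightarrow> x \<in> lorentz_cone \<Longrightarrow> 0 \<le> y \<bullet> x"
  using lorentz_cone_self_dual by blast

lemma trs_feasible_subset_lorentz_cone: "trs_feasible \<subseteq> lorentz_cone"
  by (auto simp: trs_feasible_def vconcat_in_lorentz_cone_iff)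

lemma lorentz_cone_eq_scaled_feasible:
  assumes "x \<in> lorentz_cone"
  obtains t z where "0 \<le> t" "z \<in> trs_feasible" "x = t *\<^sub>R z"
proof (cases x rule: vconcat_cases)
  case (1 a b)
  then have ab: "norm b \<le> a"
    using assms by (simp add: vconcat_in_lorentz_cone_iff)
  then have a: "0 \<le> a"
    using norm_ge_zero order_trans by blast
  \<comment> \<open>At the apex \<open>a = 0\<close> the base point is \<open>(1; 0)\<close>, since \<open>inverse 0 = 0\<close>.\<close>
  have "norm (b /\<^sub>R a) \<le> 1"
    using ab a by (cases "a = 0") (auto simp: field_simps)
  then have "vconcat 1 (b /\<^sub>R a) \<in> trs_feasible"
    by (auto simp: trs_feasible_def)
  moreover have "x = a *\<^sub>R vconcat 1 (b /\<^sub>R a)"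
    using ab by (cases "a = 0") (simp_all add: 1 scaleR_vconcat)
  ultimately show ?thesis
    using a that by blast
qed

text \<open>Both sides of the cone inequality for \<open>M x\<close> are positively homogeneous in \<open>x\<close>, so it
  suffices to test it on the base of the cone.\<close>

lemma vconcat_in_LOP_iff:
  "vconcat M0 Mbar \<in> LOP \<longleftrightarrow> (\<forall>x\<in>trs_feasible. norm (Mbar *v x) \<le> M0 \<bullet> x)"
proof -
  have LOP: "vconcat M0 Mbar \<in> LOP \<longleftrightarrow> (\<forall>x\<in>lorentz_cone. norm (Mbar *v x) \<le> M0 \<bullet> x)"
    by (simp add: LOP_def vconcat_mult_vector vconcat_in_lorentz_cone_iff)
  show ?thesis
    unfolding LOP
  proof (intro iffI ballI)
    fix x :: "real ^ 'a option"
    assume le: "\<forall>x\<in>trs_feasible. norm (Mbar *v x) \<le> M0 \<bullet> x"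
      and x: "x \<in> lorentz_cone"
    obtain t z where "0 \<le> t" "z \<in> trs_feasible" "x = t *\<^sub>R z"
      using x by (rule lorentz_cone_eq_scaled_feasible)
    with le show "norm (Mbar *v x) \<le> M0 \<bullet> x"
      by (simp add: matrix_vector_mult_scaleR mult_left_mono)
  qed (use trs_feasible_subset_lorentz_cone in blast)
qed

lemma vconcat_in_LOP_imp_top_row:
  assumes "vconcat M0 Mbar \<in> LOP"
  shows "M0 \<in> lorentz_cone"
  unfolding lorentz_cone_self_dual[of M0]
proof
  fix x :: "real ^ 'a option"
  assume "x \<in> lorentz_cone"
  with assms have "norm (Mbar *v x) \<le> M0 \<bullet> x"
    by (simp add: LOP_def vconcat_mult_vector vconcat_in_lorentz_cone_iff)
  then show "0 \<le> M0 \<bullet> x"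
    using norm_ge_zero order_trans by blast
qed

lemma vconcat_in_LOP_iff_trs_objective_nonneg:
  assumes "M0 \<in> lorentz_cone"
  shows "vconcat M0 Mbar \<in> LOP \<longleftrightarrow> (\<forall>x\<in>trs_feasible. 0 \<le> trs_objective M0 Mbar x)"
proof -
  have "norm (Mbar *v x) \<le> M0 \<bullet> x \<longleftrightarrow> 0 \<le> trs_objective M0 Mbar x"
    if "x \<in> trs_feasible" for x
  proof -
    have "0 \<le> M0 \<bullet> x"
      using assms that trs_feasible_subset_lorentz_cone
      by (blast intro: inner_lorentz_cone_nonneg)
    then show ?thesis
      by (simp add: trs_objective_def power2_le_iff_abs_le)
  qed
  then show ?thesis
    by (simp add: vconcat_in_LOP_iff)
qed

lemma continuous_on_vconcat: "continuous_on S (vconcat a)" for a :: "'a::topological_space"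
  unfolding vconcat_def
proof (intro continuous_on_vec_lambda)
  fix i :: "'b option"
  show "continuous_on S (\<lambda>b. case i of None \<Rightarrow> a | Some j \<Rightarrow> b $ j)"
    by (cases i) (auto intro: continuous_intros)
qed

lemma trs_minimum_exists:
  obtains xopt where "is_arg_min (trs_objective M0 Mbar) (\<lambda>x. x \<in> trs_feasible) xopt"
proof -
  have feasible: "trs_feasible = vconcat 1 ` cball 0 1"
    by (auto simp: trs_feasible_def)
  have "compact trs_feasible"
    unfolding feasible by (intro compact_continuous_image continuous_on_vconcat compact_cball)
  moreover have "trs_feasible \<noteq> {}"
    unfolding feasible by simp
  moreover have "continuous_on trs_feasible (trs_objective M0 Mbar)"
    unfolding trs_objective_def
    by (intro continuous_intros linear_continuous_on
        matrix_vector_mul_bounded_linear)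
  ultimately obtain xopt where "xopt \<in> trs_feasible"
    and "\<forall>x\<in>trs_feasible. trs_objective M0 Mbar xopt \<le> trs_objective M0 Mbar x"
    by (blast dest: continuous_attains_inf)
  then show ?thesis
    using that by (auto simp: is_arg_min_linorder)
qed

lemma mat_inner_outer: "mat_inner (outer y x) S = y \<bullet> (S *v x)"
proof -
  have "mat_inner (outer y x) S = (\<Sum>i\<in>UNIV. \<Sum>k\<in>UNIV. y $ i * x $ k * S $ i $ k)"
    by (simp add: mat_inner_def outer_def trace_def matrix_matrix_mult_def transpose_def
        columnvector_def rowvector_def)
  also have "\<dots> = y \<bullet> (S *v x)"
    by (simp add: inner_vec_def matrix_vector_mult_def sum_distrib_left mult_ac)
  finally show ?thesis .
qed

lemma mat_inner_outer_LOP_nonneg: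
  assumes "y \<in> lorentz_cone" "x \<in> lorentz_cone" "S \<in> LOP"
  shows "0 \<le> mat_inner (outer y x) S"
  using assms by (simp add: mat_inner_outer LOP_def inner_lorentz_cone_nonneg)

text \<open>Pairing \<open>(a; v)\<close> with the boundary vector opposite to \<open>v\<close> (with the axis, if \<open>v = 0\<close>, as
  \<open>inverse 0 = 0\<close>) gives a number that is negative exactly when \<open>(a; v)\<close> lies outside the cone.\<close>

lemma inner_opposite_boundary:
  "vconcat 1 (- (v /\<^sub>R norm v)) \<bullet> vconcat a v = a - norm v"
  by (cases "v = 0") (simp_all add: inner_vconcat dot_square_norm power2_eq_square)

theorem mainTheorem2:
  fixes M :: "real ^ 'm::finite option ^ 'n::finite option"
    and M0 :: "real ^ 'm option"
    and Mbar :: "real ^ 'm option ^ 'n"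
  assumes "min CARD('n) CARD('m) \<ge> 2"
    and "M = vconcat M0 Mbar"
  shows
    "(M0 \<notin> lorentz_cone \<longrightarrow> M \<notin> LOP) \<and>
     (M0 \<in> lorentz_cone \<longrightarrow>
       (\<exists>xopt. is_arg_min (trs_objective M0 Mbar) (\<lambda>x. x \<in> trs_feasible) xopt \<and>
               (M \<in> LOP \<longleftrightarrow> 0 \<le> trs_objective M0 Mbar xopt))) \<and>
     (\<forall>xbar :: real ^ 'm.
       let x = vconcat 1 xbar;
           vbar = Mbar *v x;
           y = vconcat 1 (- (vbar /\<^sub>R norm vbar));
           A = outer y x
       in M0 \<in> lorentz_cone \<and> norm xbar \<le> 1 \<and> M0 \<bullet> x < norm (Mbar *v x) \<longrightarrow>
          vbar \<noteq> 0 \<and>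
          (\<forall>S :: real ^ 'm option ^ 'n option. S \<in> LOP \<longrightarrow> 0 \<le> mat_inner A S) \<and>
          mat_inner A M < 0)"
proof (intro conjI impI allI)
  show "M \<notin> LOP" if "M0 \<notin> lorentz_cone"
    using that vconcat_in_LOP_imp_top_row assms(2) by blast
next
  assume M0: "M0 \<in> lorentz_cone"
  obtain xopt where min: "is_arg_min (trs_objective M0 Mbar) (\<lambda>x. x \<in> trs_feasible) xopt"
    by (rule trs_minimum_exists)
  then have "(\<forall>x\<in>trs_feasible. 0 \<le> trs_objective M0 Mbar x) \<longleftrightarrow> 0 \<le> trs_objective M0 Mbar xopt"
    by (auto simp: is_arg_min_linorder intro: order_trans)
  with min M0 show "\<exists>xopt. is_arg_min (trs_objective M0 Mbar) (\<lambda>x. x \<in> trs_feasible) xopt \<and>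
      (M \<in> LOP \<longleftrightarrow> 0 \<le> trs_objective M0 Mbar xopt)"
    using vconcat_in_LOP_iff_trs_objective_nonneg assms(2) by blast
next
  fix xbar :: "real ^ 'm"
  define x where "x = vconcat 1 xbar"
  define vbar where "vbar = Mbar *v x"
  define y where "y = vconcat 1 (- (vbar /\<^sub>R norm vbar))"
  have "vbar \<noteq> 0 \<and>
      (\<forall>S :: real ^ 'm option ^ 'n option. S \<in> LOP \<longrightarrow> 0 \<le> mat_inner (outer y x) S) \<and>
      mat_inner (outer y x) M < 0"
    if M0: "M0 \<in> lorentz_cone" and "norm xbar \<le> 1" and viol: "M0 \<bullet> x < norm vbar"
  proof (intro conjI allI impI)
    have x: "x \<in> lorentz_cone"
      using \<open>norm xbar \<le> 1\<close> by (simp add: x_def vconcat_in_lorentz_cone_iff)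
    then show "vbar \<noteq> 0"
      using inner_lorentz_cone_nonneg[OF M0 x] viol by auto
    have "y \<in> lorentz_cone"
      by (cases "vbar = 0") (simp_all add: y_def vconcat_in_lorentz_cone_iff)
    with x show "0 \<le> mat_inner (outer y x) S" if "S \<in> LOP" for S :: "real ^ 'm option ^ 'n option"
      using that by (simp add: mat_inner_outer_LOP_nonneg)
    have "mat_inner (outer y x) M = M0 \<bullet> x - norm vbar"
      by (simp only: mat_inner_outer assms(2) vconcat_mult_vector y_def
          inner_opposite_boundary flip: vbar_def)
    with viol show "mat_inner (outer y x) M < 0"
      by simp
  qed
  then show "let x = vconcat 1 xbar;
           vbar = Mbar *v x;
           y = vconcat 1 (- (vbar /\<^sub>R norm vbar));
           A = outer y x
       in M0 \<in> lorentz_cone \<and> norm xbar \<le> 1 \<and> M0 \<bullet> x < norm (Mbar *v x) \<longrightarrow>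
          vbar \<noteq> 0 \<and>
          (\<forall>S :: real ^ 'm option ^ 'n option. S \<in> LOP \<longrightarrow> 0 \<le> mat_inner A S) \<and>
          mat_inner A M < 0"
    unfolding Let_def x_def y_def vbar_def by blast
qed

end
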